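(* Let $M$ be a connected surface in $E^3$ consisting only of elliptic points (Gauss curvature $K>0$ everywhere), with position vector $x$, unit normal (Gauss map) $n$ and mean curvature $H$. Then $$\Delta^{II}n=\frac{1}{2K}\,\nabla^{I}(K,x)+2H\,n .$$
   Context: $M$ is a connected (sufficiently differentiable) surface in Euclidean 3-space $E^3$ with local coordinates $u^1,u^2$; $/i$ denotes $\partial/\partial u^i$ and repeated indices are summed. The first and second fundamental forms have components $g_{ij}=\langle x_{/i},x_{/j}\rangle$ and $b_{ij}=\langle x_{/ij},n\rangle$, with inverses $(g^{ij}),(b^{ij})$; $2H=g^{ij}b_{ij}$ and $K=\det(b_{ij})/\det(g_{ij})$. The first differential parameter of Beltrami with respect to $I$ is $\nabla^{I}(\varphi,\psi):=g^{ij}\varphi_{/i}\psi_{/j}$, where $\psi$ may be vector-valued (the formula is then taken componentwise). The second differential parameter of Beltrami with respect to $II$ is $\Delta^{II}\varphi:=-b^{ij}\nabla^{II}_i\varphi_{/j}$, where $\nabla^{II}_i$ is the covariant derivative (Levi-Civita connection of $II$) in the $u^i$ direction; it is applied componentwise to vector-valued functions. *)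

theory Defs
  imports "HOL-Analysis.Analysis"
begin

text \<open>The partial derivative of \<open>f\<close> in the \<open>i\<close>-th coordinate, meaningful where \<open>f\<close> is
  differentiable; in \<open>Ck_on k U f\<close> below, \<open>U\<close> is always open.\<close>

definition pd :: "2 \<Rightarrow> (real^2 \<Rightarrow> 'b::real_normed_vector) \<Rightarrow> real^2 \<Rightarrow> 'b"
  where "pd i f u = frechet_derivative f (at u) (axis i 1)"

primrec Ck_on :: "nat \<Rightarrow> (real^2) set \<Rightarrow> (real^2 \<Rightarrow> 'b::real_normed_vector) \<Rightarrow> bool"
  where
    "Ck_on 0 U f \<longleftrightarrow> continuous_on U f"
  | "Ck_on (Suc k) U f \<longleftrightarrow> f differentiable_on U \<and> (\<forall>i. Ck_on k U (pd i f))"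

subsection \<open>Surfaces in Euclidean 3-space\<close>

text \<open>An atlas consists of pairs \<open>(U, \<phi>)\<close> where \<open>\<phi>\<close> is the local parametrization
  (the inverse of the chart map) on the open parameter domain \<open>U\<close>.\<close>

definition C3_atlas :: "'a topology \<Rightarrow> ((real^2) set \<times> (real^2 \<Rightarrow> 'a)) set \<Rightarrow> bool"
  where "C3_atlas M A \<longleftrightarrow>
    topspace M = (\<Union>(U, \<phi>)\<in>A. \<phi> ` U) \<and>
    (\<forall>(U, \<phi>)\<in>A. open U \<and> openin M (\<phi> ` U) \<and>
       homeomorphic_map (top_of_set U) (subtopology M (\<phi> ` U)) \<phi>) \<and>
    (\<forall>(U, \<phi>)\<in>A. \<forall>(V, \<psi>)\<in>A.
       Ck_on 3 {u\<in>U. \<phi> u \<in> \<psi> ` V} (\<lambda>u. inv_into V \<psi> (\<phi> u)))"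

text \<open>The surface is a 2-manifold \<open>M\<close> of class \<open>C\<^sup>3\<close> with an immersion \<open>x\<close> into Euclidean
  3-space as position vector; for a subset of the space, take \<open>x\<close> to be the inclusion.
  Class \<open>C\<^sup>3\<close> is what is needed for the derivatives of \<open>K\<close> and the Christoffel symbols of \<open>II\<close>.\<close>

definition surface_in_E3 ::
    "'a topology \<Rightarrow> ((real^2) set \<times> (real^2 \<Rightarrow> 'a)) set \<Rightarrow> ('a \<Rightarrow> real^3) \<Rightarrow> bool"
  where "surface_in_E3 M A x \<longleftrightarrow>
    Hausdorff_space M \<and> second_countable M \<and> C3_atlas M A \<and>
    (\<forall>(U, \<phi>)\<in>A. Ck_on 3 U (x \<circ> \<phi>) \<and>
       (\<forall>u\<in>U. inj (frechet_derivative (x \<circ> \<phi>) (at u))))"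

definition gauss_map ::
    "'a topology \<Rightarrow> ((real^2) set \<times> (real^2 \<Rightarrow> 'a)) set \<Rightarrow> ('a \<Rightarrow> real^3) \<Rightarrow> ('a \<Rightarrow> real^3) \<Rightarrow> bool"
  where "gauss_map M A x n \<longleftrightarrow>
    continuous_map M euclidean n \<and>
    (\<forall>p\<in>topspace M. norm (n p) = 1) \<and>
    (\<forall>(U, \<phi>)\<in>A. \<forall>u\<in>U. \<forall>i. n (\<phi> u) \<bullet> pd i (x \<circ> \<phi>) u = 0)"

subsection \<open>Fundamental forms and curvatures in local coordinates\<close>

text \<open>Below, \<open>X\<close> and \<open>N\<close> are the position vector and the unit normal as functions of the
  local coordinates.\<close>

definition form_I :: "(real^2 \<Rightarrow> real^3) \<Rightarrow> real^2 \<Rightarrow> real^2^2"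
  where "form_I X u = (\<chi> i j. pd i X u \<bullet> pd j X u)"

definition form_II :: "(real^2 \<Rightarrow> real^3) \<Rightarrow> (real^2 \<Rightarrow> real^3) \<Rightarrow> real^2 \<Rightarrow> real^2^2"
  where "form_II X N u = (\<chi> i j. pd j (pd i X) u \<bullet> N u)"

definition mean_curvature :: "(real^2 \<Rightarrow> real^3) \<Rightarrow> (real^2 \<Rightarrow> real^3) \<Rightarrow> real^2 \<Rightarrow> real"
  where "mean_curvature X N u =
    (\<Sum>i\<in>UNIV. \<Sum>j\<in>UNIV. matrix_inv (form_I X u) $ i $ j * form_II X N u $ i $ j) / 2"

definition gauss_curvature :: "(real^2 \<Rightarrow> real^3) \<Rightarrow> (real^2 \<Rightarrow> real^3) \<Rightarrow> real^2 \<Rightarrow> real"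
  where "gauss_curvature X N u = det (form_II X N u) / det (form_I X u)"

subsection \<open>Differential parameters of Beltrami\<close>

text \<open>Here \<open>h\<close> is the component matrix of a (possibly indefinite or negative definite) metric,
  such as the second fundamental form. The scalar product of a real with a vector makes the
  formulas act componentwise on vector-valued functions.\<close>

definition christoffel :: "(real^2 \<Rightarrow> real^2^2) \<Rightarrow> 2 \<Rightarrow> 2 \<Rightarrow> 2 \<Rightarrow> real^2 \<Rightarrow> real"
  where "christoffel h k i j u =
    (\<Sum>l\<in>UNIV. matrix_inv (h u) $ k $ l *
       (pd i (\<lambda>v. h v $ j $ l) u + pd j (\<lambda>v. h v $ i $ l) u - pd l (\<lambda>v. h v $ i $ j) u)) / 2"

text \<open>The component \<open>\<nabla>\<^sub>i f\<^sub>j\<close> of the covariant derivative of the differential of \<open>f\<close>.\<close>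

definition cov_deriv2 ::
    "(real^2 \<Rightarrow> real^2^2) \<Rightarrow> 2 \<Rightarrow> 2 \<Rightarrow> (real^2 \<Rightarrow> 'b::real_normed_vector) \<Rightarrow> real^2 \<Rightarrow> 'b"
  where "cov_deriv2 h i j f u =
    pd i (pd j f) u - (\<Sum>k\<in>UNIV. christoffel h k i j u *\<^sub>R pd k f u)"

definition beltrami1 ::
    "(real^2 \<Rightarrow> real^2^2) \<Rightarrow> (real^2 \<Rightarrow> real) \<Rightarrow> (real^2 \<Rightarrow> 'b::real_normed_vector) \<Rightarrow> real^2 \<Rightarrow> 'b"
  where "beltrami1 h f \<psi> u =
    (\<Sum>i\<in>UNIV. \<Sum>j\<in>UNIV. (matrix_inv (h u) $ i $ j * pd i f u) *\<^sub>R pd j \<psi> u)"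

definition beltrami2 ::
    "(real^2 \<Rightarrow> real^2^2) \<Rightarrow> (real^2 \<Rightarrow> 'b::real_normed_vector) \<Rightarrow> real^2 \<Rightarrow> 'b"
  where "beltrami2 h f u =
    - (\<Sum>i\<in>UNIV. \<Sum>j\<in>UNIV. matrix_inv (h u) $ i $ j *\<^sub>R cov_deriv2 h i j f u)"

end

theory Submission
  imports Defs
begin

text \<open>Both sides are compared along the normal \<open>n\<close> and the tangent vectors \<open>x\<^sub>m\<close>.
  Differentiating \<open>\<langle>n\<^sub>j, n\<rangle> = 0\<close> gives \<open>\<langle>n\<^sub>i\<^sub>j, n\<rangle> = - \<langle>n\<^sub>i, n\<^sub>j\<rangle>\<close>, which contracts to \<open>2H\<close>
  by the Weingarten equations in the form \<open>b\<^sup>i\<^sup>j n\<^sub>j = - g\<^sup>i\<^sup>k x\<^sub>k\<close>. For the tangential part,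
  \<open>\<langle>n\<^sub>k, x\<^sub>m\<rangle> = - b\<^sub>k\<^sub>m\<close> turns the connection term of \<open>\<langle>\<nabla>\<^sub>i n\<^sub>j, x\<^sub>m\<rangle>\<close> into a Christoffel symbol of the
  first kind; after contraction what remains is
  \<open>b\<^sup>i\<^sup>j \<partial>\<^sub>m b\<^sub>i\<^sub>j / 2 - g\<^sup>i\<^sup>k \<langle>x\<^sub>i\<^sub>m, x\<^sub>k\<rangle> = \<partial>\<^sub>m (ln (det b / det g)) / 2 = \<partial>\<^sub>m K / (2K)\<close>. The Codazzi
  equations do not enter. The normal is only assumed continuous; it is of class \<open>C\<^sup>2\<close> because
  it equals the normalized cross product of the tangent vectors up to a locally constant sign.\<close>

subsection \<open>Calculus of coordinate derivatives\<close>

lemma pd_eqI: "(f has_derivative f') (at u) \<Longrightarrow> pd i f u = f' (axis i 1)"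
  by (metis frechet_derivative_at pd_def)

text \<open>Both functions have the same derivatives at \<open>u\<close>, so the choice behind
  \<open>frechet_derivative\<close> selects the same map even where no derivative exists.\<close>

lemma pd_cong:
  assumes "open U" "u \<in> U" "\<And>v. v \<in> U \<Longrightarrow> f v = g v"
  shows "pd i f u = pd i g u"
proof -
  have "(f has_derivative f') (at u) \<longleftrightarrow> (g has_derivative f') (at u)" for f'
    using has_derivative_transform_within_open[OF _ assms(1,2)] assms(3) by metis
  then show ?thesis
    by (simp add: pd_def frechet_derivative_def)
qed

lemma pd_const [simp]: "pd i (\<lambda>v. c) u = 0"
  by (simp add: pd_def)

lemma pd_add:
  assumes "f differentiable (at u)" "g differentiable (at u)"
  shows "pd i (\<lambda>v. f v + g v) u = pd i f u + pd i g u"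
  using pd_eqI[OF has_derivative_add[OF assms[unfolded frechet_derivative_works]], of i]
  by (simp add: pd_def)

lemma pd_bilinear:
  assumes "bounded_bilinear B" "f differentiable (at u)" "g differentiable (at u)"
  shows "pd i (\<lambda>v. B (f v) (g v)) u = B (f u) (pd i g u) + B (pd i f u) (g u)"
  using pd_eqI[OF bounded_bilinear.FDERIV[OF assms(1) assms(2,3)[unfolded frechet_derivative_works]], of i]
  by (simp add: pd_def)

lemmas pd_inner = pd_bilinear[OF bounded_bilinear_inner]
lemmas pd_mult = pd_bilinear[OF bounded_bilinear_mult]

lemma pd_minus:
  assumes "f differentiable (at u)"
  shows "pd i (\<lambda>v. - f v) u = - pd i f u"
  using pd_eqI[OF has_derivative_minus[OF assms[unfolded frechet_derivative_works]], of i]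
  by (simp add: pd_def)

lemma pd_diff:
  assumes "f differentiable (at u)" "g differentiable (at u)"
  shows "pd i (\<lambda>v. f v - g v) u = pd i f u - pd i g u"
  using pd_eqI[OF has_derivative_diff[OF assms[unfolded frechet_derivative_works]], of i]
  by (simp add: pd_def)

lemma pd_divide:
  fixes f g :: "real^2 \<Rightarrow> real"
  assumes "f differentiable (at u)" "g differentiable (at u)" "g u \<noteq> 0"
  shows "pd i (\<lambda>v. f v / g v) u = (pd i f u * g u - f u * pd i g u) / (g u)\<^sup>2"
proof -
  have "((\<lambda>v. f v / g v) has_derivative
      (\<lambda>h. (frechet_derivative f (at u) h * g u - f u * frechet_derivative g (at u) h) / (g u * g u)))
      (at u)"
    using assms by (intro has_derivative_divide') (simp_all add: frechet_derivative_works)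
  from pd_eqI[OF this, of i] show ?thesis
    by (simp add: pd_def power2_eq_square)
qed

text \<open>The value is a polynomial in \<open>inverse (norm (f u))\<close>, \<open>f u\<close> and
  \<open>pd i f u\<close>; this form lets the induction in \<open>Ck_on_inverse_norm\<close>
  close.\<close>

lemma pd_inverse_norm:
  fixes f :: "real^2 \<Rightarrow> 'b::real_inner"
  assumes "f differentiable (at u)" "f u \<noteq> 0"
  shows "pd i (\<lambda>v. inverse (norm (f v))) u
    = - (inverse (norm (f u)) * (inverse (norm (f u)) * inverse (norm (f u))) * (pd i f u \<bullet> f u))"
proof -
  let ?F = "frechet_derivative f (at u)"
  have "((\<lambda>v. norm (f v)) has_derivative (\<lambda>h. ?F h \<bullet> sgn (f u))) (at u)"
    by (rule has_derivative_compose[OF assms(1)[unfolded frechet_derivative_works]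
          has_derivative_norm[OF assms(2)]])
  from Deriv.has_derivative_inverse[OF _ this] assms(2)
  have "((\<lambda>v. inverse (norm (f v))) has_derivative
    (\<lambda>h. - (inverse (norm (f u)) * (?F h \<bullet> sgn (f u)) * inverse (norm (f u))))) (at u)"
    by simp
  from pd_eqI[OF this, of i] show ?thesis
    by (simp add: pd_def sgn_div_norm)
qed

subsection \<open>Functions of class \<open>C\<^sup>k\<close>\<close>

lemma differentiable_onD_open:
  "f differentiable_on U \<Longrightarrow> open U \<Longrightarrow> u \<in> U \<Longrightarrow> f differentiable (at u)"
  by (metis at_within_open differentiable_on_def)

lemma Ck_on_subset: "Ck_on k U f \<Longrightarrow> V \<subseteq> U \<Longrightarrow> Ck_on k V f"
  by (induction k arbitrary: f) (auto intro: continuous_on_subset differentiable_on_subset)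

lemma Ck_on_cong:
  assumes "open U" "\<And>v. v \<in> U \<Longrightarrow> f v = g v" "Ck_on k U f"
  shows "Ck_on k U g"
  using assms(2,3)
proof (induction k arbitrary: f g)
  case 0
  then show ?case by (metis Ck_on.simps(1) continuous_on_cong)
next
  case (Suc k)
  have "g differentiable_on U"
    using Suc.prems differentiable_on_def
    by (metis (no_types, lifting) Ck_on.simps(2) differentiable_transform_within zero_less_one)
  moreover have "Ck_on k U (pd i g)" for i
    using Suc.prems by (intro Suc.IH[of "pd i f" "pd i g"] pd_cong[OF assms(1)]) auto
  ultimately show ?case by simp
qed

lemma Ck_on_Suc_imp: "Ck_on (Suc k) U f \<Longrightarrow> Ck_on k U f"
  by (induction k arbitrary: f) (auto intro: differentiable_imp_continuous_on)

lemma Ck_on_const [simp]: "Ck_on k U (\<lambda>v. c)"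
proof (induction k arbitrary: c)
  case (Suc k)
  have "pd i (\<lambda>v. c) = (\<lambda>v. 0)" for i
    by (simp add: fun_eq_iff)
  then show ?case using Suc by simp
qed simp

lemma Ck_on_add:
  assumes "open U" "Ck_on k U f" "Ck_on k U g"
  shows "Ck_on k U (\<lambda>v. f v + g v)"
  using assms(2,3)
proof (induction k arbitrary: f g)
  case 0
  then show ?case by (simp add: continuous_on_add)
next
  case (Suc k)
  have d: "f differentiable (at u)" "g differentiable (at u)" if "u \<in> U" for u
    using Suc.prems that by (auto intro: differentiable_onD_open assms(1))
  have "Ck_on k U (pd i (\<lambda>v. f v + g v))" for i
  proof (rule Ck_on_cong[OF assms(1)])
    show "pd i f v + pd i g v = pd i (\<lambda>v. f v + g v) v" if "v \<in> U" for v
      using pd_add[OF d[OF that]] by simp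
    show "Ck_on k U (\<lambda>v. pd i f v + pd i g v)"
      using Suc.prems by (intro Suc.IH) auto
  qed
  moreover have "(\<lambda>v. f v + g v) differentiable_on U"
    using Suc.prems by simp
  ultimately show ?case by simp
qed

text \<open>Serves products, scalings, inner products and cross products at once. Each term of the
  product rule keeps one undifferentiated factor, whose order is lowered from \<open>Suc k\<close>
  to \<open>k\<close> before the induction hypothesis applies.\<close>

lemma Ck_on_bilinear:
  assumes "open U" "bounded_bilinear B" "Ck_on k U f" "Ck_on k U g"
  shows "Ck_on k U (\<lambda>v. B (f v) (g v))"
  using assms(3,4)
proof (induction k arbitrary: f g)
  case 0
  then show ?case
    by (simp add: bounded_bilinear.continuous_on[OF assms(2)])
next
  case (Suc k)
  have d: "f differentiable (at u)" "g differentiable (at u)" if "u \<in> U" for u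
    using Suc.prems that by (auto intro: differentiable_onD_open assms(1))
  have "Ck_on k U (pd i (\<lambda>v. B (f v) (g v)))" for i
  proof (rule Ck_on_cong[OF assms(1)])
    show "B (f v) (pd i g v) + B (pd i f v) (g v) = pd i (\<lambda>v. B (f v) (g v)) v" if "v \<in> U" for v
      using pd_bilinear[OF assms(2) d[OF that]] by simp
    have "Ck_on k U (pd i f)" "Ck_on k U (pd i g)"
      using Suc.prems by auto
    then show "Ck_on k U (\<lambda>v. B (f v) (pd i g v) + B (pd i f v) (g v))"
      by (rule Ck_on_add[OF assms(1) Suc.IH[OF Ck_on_Suc_imp[OF Suc.prems(1)]]
            Suc.IH[OF _ Ck_on_Suc_imp[OF Suc.prems(2)]], rotated])
  qed
  moreover have "(\<lambda>v. B (f v) (g v)) differentiable_on U"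
    using bounded_bilinear.FDERIV[OF assms(2) d[unfolded frechet_derivative_works]]
    by (meson differentiableI differentiable_at_imp_differentiable_on)
  ultimately show ?case by simp
qed

text \<open>A bootstrap: the derivative of 1/|f| is a polynomial in 1/|f|, f and a derivative of f,
  so order \<open>k\<close> for 1/|f| itself yields order \<open>k\<close> for its
  derivative.\<close>

lemma Ck_on_inverse_norm:
  fixes f :: "real^2 \<Rightarrow> 'b::real_inner"
  assumes "open U" "Ck_on k U f" "\<And>v. v \<in> U \<Longrightarrow> f v \<noteq> 0"
  shows "Ck_on k U (\<lambda>v. inverse (norm (f v)))"
  using assms(2)
proof (induction k)
  case 0
  then show ?case using assms(3) by (auto intro!: continuous_intros)
next
  case (Suc k)
  let ?g = "\<lambda>v. inverse (norm (f v))"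
  have d: "f differentiable (at u)" if "u \<in> U" for u
    using Suc.prems that by (auto intro: differentiable_onD_open assms(1))
  have f: "Ck_on k U f" and g: "Ck_on k U ?g"
    using Ck_on_Suc_imp[OF Suc.prems] Suc.IH by auto
  have "Ck_on k U (pd i ?g)" for i
  proof (rule Ck_on_cong[OF assms(1)])
    \<comment> \<open>The sign is written as a factor so that closure under products and constants
      covers the whole expression.\<close>
    show "- 1 * ((?g v * (?g v * ?g v)) * (pd i f v \<bullet> f v)) = pd i ?g v" if "v \<in> U" for v
      using pd_inverse_norm[OF d[OF that] assms(3)[OF that], of i] by simp
    show "Ck_on k U (\<lambda>v. - 1 * ((?g v * (?g v * ?g v)) * (pd i f v \<bullet> f v)))"
      using Suc.prems
      by (intro Ck_on_bilinear[OF assms(1) bounded_bilinear_mult]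
          Ck_on_bilinear[OF assms(1) bounded_bilinear_inner] g f Ck_on_const) simp
  qed
  moreover have "?g differentiable_on U"
  proof (rule differentiable_at_imp_differentiable_on)
    fix u assume u: "u \<in> U"
    have "(\<lambda>v. norm (f v)) differentiable (at u)"
      using differentiable_compose[OF differentiable_norm_at d[OF u]] assms(3)[OF u] by simp
    then show "?g differentiable (at u)"
      using assms(3)[OF u] by (simp add: differentiable_inverse)
  qed
  ultimately show ?case by simp
qed

subsection \<open>Symmetry of second derivatives\<close>

lemma DERIV_along_axis:
  fixes f :: "real^2 \<Rightarrow> real"
  assumes "f differentiable (at (c + t *\<^sub>R axis i 1))"
  shows "((\<lambda>t. f (c + t *\<^sub>R axis i 1)) has_real_derivative pd i f (c + t *\<^sub>R axis i 1)) (at t)"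
proof -
  let ?F = "frechet_derivative f (at (c + t *\<^sub>R axis i 1))"
  have F: "(f has_derivative ?F) (at (c + t *\<^sub>R axis i 1))"
    using assms by (simp add: frechet_derivative_works)
  have "((\<lambda>t. c + t *\<^sub>R axis i 1 :: real^2) has_derivative (\<lambda>s. s *\<^sub>R axis i 1)) (at t)"
    by (auto intro!: derivative_eq_intros)
  from has_derivative_compose[OF this F]
  have "((\<lambda>t. f (c + t *\<^sub>R axis i 1)) has_derivative (\<lambda>s. ?F (s *\<^sub>R axis i 1))) (at t)" .
  moreover have "?F (s *\<^sub>R axis i 1) = pd i f (c + t *\<^sub>R axis i 1) * s" for s
    using linear_cmul[OF linear_frechet_derivative[OF assms]] by (simp add: pd_def)
  ultimately show ?thesis
    by (simp add: has_field_derivative_def)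
qed

text \<open>The mean value theorem is applied twice: along axis \<open>i\<close> to the difference
  of f on two parallel sides, then along axis \<open>j\<close> to \<open>pd i f\<close>. By the
  triangle inequality all points involved lie within \<open>2 * h\<close> of
  \<open>u\<close>.\<close>

lemma mixed_difference_mean_value:
  fixes f :: "real^2 \<Rightarrow> real"
  assumes "\<And>v. dist u v \<le> 2 * h \<Longrightarrow> f differentiable (at v)"
    and "\<And>v. dist u v \<le> 2 * h \<Longrightarrow> pd i f differentiable (at v)"
    and "h > 0"
  obtains w where "dist u w \<le> 2 * h"
    "f (u + h *\<^sub>R axis i 1 + h *\<^sub>R axis j 1) - f (u + h *\<^sub>R axis i 1) - f (u + h *\<^sub>R axis j 1) + f u
      = h\<^sup>2 * pd j (pd i f) w"
proof -
  have d: "dist u (u + s *\<^sub>R axis i 1 + t *\<^sub>R axis j 1) \<le> 2 * h"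
    if "0 \<le> s" "s \<le> h" "0 \<le> t" "t \<le> h" for s t
    using that norm_triangle_ineq[of "s *\<^sub>R axis i 1" "t *\<^sub>R axis j 1 :: real^2"]
    by (simp add: dist_norm norm_minus_commute algebra_simps)
  have d0: "dist u (u + s *\<^sub>R axis i 1) \<le> 2 * h" if "0 \<le> s" "s \<le> h" for s
    using d[of s 0] that by simp
  let ?\<phi> = "\<lambda>s. f ((u + h *\<^sub>R axis j 1) + s *\<^sub>R axis i 1) - f (u + s *\<^sub>R axis i 1)"
  let ?\<phi>' = "\<lambda>s. pd i f ((u + h *\<^sub>R axis j 1) + s *\<^sub>R axis i 1) - pd i f (u + s *\<^sub>R axis i 1)"
  have "(?\<phi> has_real_derivative ?\<phi>' s) (at s)" if "0 \<le> s" "s \<le> h" for s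
    using that d[of s h] d0[of s] \<open>h > 0\<close>
    by (intro DERIV_diff DERIV_along_axis assms(1)) (simp_all add: algebra_simps)
  from MVT2[OF \<open>h > 0\<close>, of ?\<phi> ?\<phi>', OF this]
  obtain s where s: "0 < s" "s < h" "?\<phi> h - ?\<phi> 0 = h * ?\<phi>' s"
    by auto
  let ?\<psi> = "\<lambda>t. pd i f ((u + s *\<^sub>R axis i 1) + t *\<^sub>R axis j 1)"
  let ?\<psi>' = "\<lambda>t. pd j (pd i f) ((u + s *\<^sub>R axis i 1) + t *\<^sub>R axis j 1)"
  have "(?\<psi> has_real_derivative ?\<psi>' t) (at t)" if "0 \<le> t" "t \<le> h" for t
    using that d[of s t] s by (intro DERIV_along_axis assms(2)) (simp_all add: algebra_simps)
  from MVT2[OF \<open>h > 0\<close>, of ?\<psi> ?\<psi>', OF this]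
  obtain t where t: "0 < t" "t < h" "?\<psi> h - ?\<psi> 0 = h * ?\<psi>' t"
    by auto
  have "?\<phi>' s = ?\<psi> h - ?\<psi> 0"
    by (simp add: algebra_simps)
  then show ?thesis
    using that[OF d[of s t]] s t by (simp add: algebra_simps power2_eq_square)
qed

text \<open>The mixed second difference is symmetric in \<open>i\<close> and \<open>j\<close>, and
  it equals \<open>h\<^sup>2\<close> times either mixed derivative at some point near
  \<open>u\<close>. Continuity then rules out distinct values at \<open>u\<close>.\<close>

lemma pd_commute_real:
  fixes f :: "real^2 \<Rightarrow> real"
  assumes "open U" "Ck_on 2 U f" "u \<in> U"
  shows "pd i (pd j f) u = pd j (pd i f) u"
proof (rule ccontr)
  assume ne: "pd i (pd j f) u \<noteq> pd j (pd i f) u"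
  \<comment> \<open>Half the gap: two errors below \<open>e\<close> cannot add up to it.\<close>
  define e where "e = dist (pd i (pd j f) u) (pd j (pd i f) u) / 2"
  have "e > 0" using ne by (simp add: e_def)
  have diff: "f differentiable (at v)" "pd k f differentiable (at v)"
    and cont: "continuous_on U (pd k (pd l f))" if "v \<in> U" for v k l
    using assms that by (auto simp: numeral_2_eq_2 intro: differentiable_onD_open)
  have "\<exists>r>0. \<forall>v. dist u v < r \<longrightarrow> v \<in> U \<and> dist (pd k (pd l f) v) (pd k (pd l f) u) < e" for k l
  proof -
    obtain r1 where r1: "r1 > 0" "\<And>v. dist u v < r1 \<Longrightarrow> v \<in> U"
      using assms(1,3) by (auto simp: open_contains_ball subset_eq)
    obtain r2 where "r2 > 0"
        "\<And>v. v \<in> U \<Longrightarrow> dist v u < r2 \<Longrightarrow> dist (pd k (pd l f) v) (pd k (pd l f) u) < e"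
      using cont[OF assms(3), of k l] \<open>e > 0\<close> assms(3) unfolding continuous_on_iff by metis
    with r1 show ?thesis
      by (intro exI[of _ "min r1 r2"]) (auto simp: dist_commute)
  qed
  then obtain r where r: "\<And>k l. r k l > 0"
      "\<And>k l v. dist u v < r k l \<Longrightarrow> v \<in> U"
      "\<And>k l v. dist u v < r k l \<Longrightarrow> dist (pd k (pd l f) v) (pd k (pd l f) u) < e"
    by metis
  \<comment> \<open>Dividing by 3 puts \<open>2 * h\<close>, the reach of the mean value points,
    strictly below both radii.\<close>
  define h where "h = min (r i j) (r j i) / 3"
  have h: "h > 0" "2 * h < r i j" "2 * h < r j i"
    using r(1)[of i j] r(1)[of j i] by (auto simp: h_def)
  have U: "v \<in> U" if "dist u v \<le> 2 * h" for v
    using r(2)[of v i j] h that by simp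
  let ?S = "\<lambda>i j. f (u + h *\<^sub>R axis i 1 + h *\<^sub>R axis j 1) - f (u + h *\<^sub>R axis i 1) - f (u + h *\<^sub>R axis j 1) + f u"
  obtain w where w: "dist u w \<le> 2 * h" "?S i j = h\<^sup>2 * pd j (pd i f) w"
    by (rule mixed_difference_mean_value[where f=f and u=u and h=h and i=i and j=j])
      (auto intro: diff U h)
  obtain w' where w': "dist u w' \<le> 2 * h" "?S j i = h\<^sup>2 * pd i (pd j f) w'"
    by (rule mixed_difference_mean_value[where f=f and u=u and h=h and i=j and j=i])
      (auto intro: diff U h)
  have "?S i j = ?S j i"
    by (simp add: algebra_simps)
  then have "pd j (pd i f) w = pd i (pd j f) w'"
    using w(2) w'(2) h(1) by simp
  then have "dist (pd i (pd j f) u) (pd j (pd i f) u) < 2 * e"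
    using r(3)[of w j i] r(3)[of w' i j] w(1) w'(1) h
      dist_triangle_half_r[of "pd j (pd i f) w" "pd i (pd j f) u" "2 * e" "pd j (pd i f) u"]
    by simp
  then show False
    by (simp add: e_def)
qed

text \<open>Scalar products with basis vectors commute with \<open>pd\<close>, which reduces the
  claim to the real components.\<close>

lemma pd_commute:
  fixes f :: "real^2 \<Rightarrow> 'b::euclidean_space"
  assumes "open U" "Ck_on 2 U f" "u \<in> U"
  shows "pd i (pd j f) u = pd j (pd i f) u"
proof (rule euclidean_eqI)
  fix b :: 'b
  have diff: "f differentiable (at v)" "pd k f differentiable (at v)" if "v \<in> U" for v k
    using assms that by (auto simp: numeral_2_eq_2 intro: differentiable_onD_open)
  have 1: "pd k (\<lambda>v. f v \<bullet> b) v = pd k f v \<bullet> b" if "v \<in> U" for k v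
    using pd_inner[OF diff(1)[OF that] differentiable_const] by simp
  have 2: "pd l (pd k (\<lambda>v. f v \<bullet> b)) u = pd l (pd k f) u \<bullet> b" for k l
    using pd_cong[OF assms(1,3) 1] pd_inner[OF diff(2)[OF assms(3)] differentiable_const] by simp
  have "Ck_on 2 U (\<lambda>v. f v \<bullet> b)"
    using assms by (intro Ck_on_bilinear[OF _ bounded_bilinear_inner]) auto
  from pd_commute_real[OF assms(1) this assms(3)]
  show "pd i (pd j f) u \<bullet> b = pd j (pd i f) u \<bullet> b"
    by (metis 2)
qed

subsection \<open>Linear algebra in dimensions two and three\<close>

lemma matrix_inv_mult_component:
  fixes B :: "real^'n^'n"
  assumes "det B \<noteq> 0"
  shows "(\<Sum>k\<in>UNIV. matrix_inv B $ i $ k * B $ k $ j) = (if i = j then 1 else 0)"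
    and "(\<Sum>k\<in>UNIV. B $ i $ k * matrix_inv B $ k $ j) = (if i = j then 1 else 0)"
proof -
  obtain B' where "B ** B' = mat 1 \<and> B' ** B = mat 1"
    using assms by (auto simp: invertible_det_nz[symmetric] invertible_def)
  then have "B ** matrix_inv B = mat 1 \<and> matrix_inv B ** B = mat 1"
    unfolding matrix_inv_def by (rule someI)
  then show "(\<Sum>k\<in>UNIV. matrix_inv B $ i $ k * B $ k $ j) = (if i = j then 1 else 0)"
      "(\<Sum>k\<in>UNIV. B $ i $ k * matrix_inv B $ k $ j) = (if i = j then 1 else 0)"
    by (simp_all add: matrix_matrix_mult_def mat_def vec_eq_iff)
qed

text \<open>Cramer's rule, solved from the four entries of the equation inverse times matrix =
  identity.\<close>

lemma matrix_inv_2: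
  fixes B :: "real^2^2"
  assumes "det B \<noteq> 0"
  shows "matrix_inv B $ 1 $ 1 = B $ 2 $ 2 / det B" "matrix_inv B $ 1 $ 2 = - B $ 1 $ 2 / det B"
    "matrix_inv B $ 2 $ 1 = - B $ 2 $ 1 / det B" "matrix_inv B $ 2 $ 2 = B $ 1 $ 1 / det B"
proof -
  let ?a = "B $ 1 $ 1" and ?b = "B $ 1 $ 2" and ?c = "B $ 2 $ 1" and ?d = "B $ 2 $ 2"
  let ?I = "matrix_inv B"
  have eqs: "?I $ 1 $ 1 * ?a + ?I $ 1 $ 2 * ?c = 1" "?I $ 1 $ 1 * ?b + ?I $ 1 $ 2 * ?d = 0"
      "?I $ 2 $ 1 * ?a + ?I $ 2 $ 2 * ?c = 0" "?I $ 2 $ 1 * ?b + ?I $ 2 $ 2 * ?d = 1"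
    using matrix_inv_mult_component(1)[OF assms, of 1 1] matrix_inv_mult_component(1)[OF assms, of 1 2]
      matrix_inv_mult_component(1)[OF assms, of 2 1] matrix_inv_mult_component(1)[OF assms, of 2 2]
    by (simp_all add: sum_2)
  have "?I $ 1 $ 1 * det B = ?d" "?I $ 1 $ 2 * det B = - ?b"
      "?I $ 2 $ 1 * det B = - ?c" "?I $ 2 $ 2 * det B = ?a"
    unfolding det_2 using eqs by algebra+
  then show "?I $ 1 $ 1 = ?d / det B" "?I $ 1 $ 2 = - ?b / det B"
      "?I $ 2 $ 1 = - ?c / det B" "?I $ 2 $ 2 = ?a / det B"
    using assms by (simp_all only: eq_divide_eq if_True not_False_eq_True)
qed

lemma matrix_inv_symmetric_2:
  fixes B :: "real^2^2"
  assumes "det B \<noteq> 0" "\<And>i j. B $ i $ j = B $ j $ i"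
  shows "matrix_inv B $ i $ j = matrix_inv B $ j $ i"
proof -
  have "\<forall>i j. matrix_inv B $ i $ j = matrix_inv B $ j $ i"
    by (simp add: forall_2 matrix_inv_2[OF assms(1)] assms(2)[of 1 2])
  then show ?thesis by simp
qed

text \<open>Jacobi's formula: the derivative of det h is det h times the trace of the inverse of h
  times dh.\<close>

lemma pd_det_2:
  fixes h :: "real^2 \<Rightarrow> real^2^2"
  assumes "\<And>i j. (\<lambda>v. h v $ i $ j) differentiable (at u)" "det (h u) \<noteq> 0"
  shows "pd m (\<lambda>v. det (h v)) u =
    det (h u) * (\<Sum>i\<in>UNIV. \<Sum>j\<in>UNIV. matrix_inv (h u) $ i $ j * pd m (\<lambda>v. h v $ j $ i) u)"
proof -
  have "pd m (\<lambda>v. det (h v)) u =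
      h u $ 1 $ 1 * pd m (\<lambda>v. h v $ 2 $ 2) u + pd m (\<lambda>v. h v $ 1 $ 1) u * h u $ 2 $ 2
      - (h u $ 1 $ 2 * pd m (\<lambda>v. h v $ 2 $ 1) u + pd m (\<lambda>v. h v $ 1 $ 2) u * h u $ 2 $ 1)"
    unfolding det_2
    by (simp add: pd_diff pd_mult assms(1) differentiable_mult)
  moreover have "det (h u) * matrix_inv (h u) $ 1 $ 1 = h u $ 2 $ 2"
      "det (h u) * matrix_inv (h u) $ 1 $ 2 = - h u $ 1 $ 2"
      "det (h u) * matrix_inv (h u) $ 2 $ 1 = - h u $ 2 $ 1"
      "det (h u) * matrix_inv (h u) $ 2 $ 2 = h u $ 1 $ 1"
    using assms(2) by (simp_all add: matrix_inv_2)
  ultimately show ?thesis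
    unfolding sum_2 by algebra
qed

text \<open>Lagrange's identity; it makes det g positive wherever the tangent vectors are
  independent.\<close>

lemma det_gram_2:
  fixes a :: "2 \<Rightarrow> real^3"
  shows "det (\<chi> i j. a i \<bullet> a j) = (norm (cross3 (a 1) (a 2)))\<^sup>2"
  unfolding power2_norm_eq_inner dot_cross
  by (simp add: det_2 inner_commute)

text \<open>The double product n x (a x b) is a combination of a and b with coefficients <n,b> and
  -<n,a>, hence zero, so w is parallel to n.\<close>

lemma unit_normal_eq:
  fixes a b n :: "real^3"
  assumes "norm n = 1" "n \<bullet> a = 0" "n \<bullet> b = 0"
  defines "w \<equiv> cross3 a b"
  shows "w = (n \<bullet> w) *\<^sub>R n" and "\<bar>n \<bullet> w\<bar> = norm w"
proof -
  have "cross3 n w = 0"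
    using assms(2,3) unfolding w_def by (simp add: Lagrange)
  \<comment> \<open>Expanding this product as <n,w> n - <n,n> w gives the coefficient of n.\<close>
  then have "cross3 n (cross3 n w) = 0"
    by simp
  then show *: "w = (n \<bullet> w) *\<^sub>R n"
    using assms(1) by (simp add: Lagrange norm_eq_1)
  have "norm w = norm ((n \<bullet> w) *\<^sub>R n)"
    using * by simp
  then show "\<bar>n \<bullet> w\<bar> = norm w"
    using assms(1) by simp
qed

text \<open>The difference v - v' is both parallel and orthogonal to the nonzero vector a x b, so it
  vanishes.\<close>

lemma orthogonal_frame_eqI:
  fixes v v' a b n :: "real^3"
  assumes "norm n = 1" "n \<bullet> a = 0" "n \<bullet> b = 0" "cross3 a b \<noteq> 0"
    and "v \<bullet> a = v' \<bullet> a" "v \<bullet> b = v' \<bullet> b" "v \<bullet> n = v' \<bullet> n"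
  shows "v = v'"
proof -
  have "cross3 (v - v') (cross3 a b) = 0"
    using assms(5,6) by (simp add: Lagrange inner_diff_left)
  moreover have "(v - v') \<bullet> cross3 a b = 0"
    using unit_normal_eq(1)[OF assms(1-3)] assms(7) inner_scaleR_right[of "v - v'" _ n]
    by (metis inner_diff_left mult_zero_right right_minus_eq)
  ultimately show ?thesis
    using norm_and_cross_eq_0[of "v - v'"] assms(4) by auto
qed

lemma inj_linear_cross3_axis:
  fixes F :: "real^2 \<Rightarrow> real^3"
  assumes "linear F" "inj F"
  shows "cross3 (F (axis 1 1)) (F (axis 2 1)) \<noteq> 0"
proof
  assume "cross3 (F (axis 1 1)) (F (axis 2 1)) = 0"
  moreover have "F (axis 1 1) \<noteq> 0"
    using assms linear_injective_0 by (metis axis_eq_0_iff zero_neq_one)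
  ultimately obtain c where "F (axis 2 1) = c *\<^sub>R F (axis 1 1)"
    by (auto simp: cross_eq_0 collinear_lemma intro: that[of 0])
  then have "F (axis 2 1) = F (c *\<^sub>R axis 1 1)"
    using assms(1) by (simp add: linear_cmul)
  then have "axis 2 1 = (c *\<^sub>R axis 1 1 :: real^2)"
    using assms(2) by (simp add: inj_eq)
  then have "(axis 2 1 :: real^2) $ 2 = (c *\<^sub>R axis 1 1 :: real^2) $ 2"
    by simp
  then show False
    by (simp add: axis_def)
qed

subsection \<open>Regularity of the unit normal\<close>

lemma bounded_bilinear_cross3: "bounded_bilinear cross3"
  using bilinear_cross by (simp add: bilinear_conv_bounded_bilinear)

lemma unit_normal_locally_Ck:
  fixes X N :: "real^2 \<Rightarrow> real^3"
  assumes "open U" "Ck_on (Suc k) U X" "continuous_on U N"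
    and "\<And>v. v \<in> U \<Longrightarrow> norm (N v) = 1"
    and "\<And>v i. v \<in> U \<Longrightarrow> N v \<bullet> pd i X v = 0"
    and "\<And>v. v \<in> U \<Longrightarrow> cross3 (pd 1 X v) (pd 2 X v) \<noteq> 0"
    and "u \<in> U"
  obtains V where "open V" "u \<in> V" "V \<subseteq> U" "Ck_on k V N"
proof
  define W where "W = (\<lambda>v. cross3 (pd 1 X v) (pd 2 X v))"
  have W: "Ck_on k U W"
    unfolding W_def using assms(2) by (intro Ck_on_bilinear[OF assms(1) bounded_bilinear_cross3]) auto
  \<comment> \<open>The sign of the normal relative to \<open>W\<close>, frozen at \<open>u\<close>;
    by continuity it persists on the neighbourhood \<open>V\<close> defined next.\<close>
  define s where "s = sgn (N u \<bullet> W u)"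
  define V where "V = {v \<in> U. 0 < s * (N v \<bullet> W v)}"
  have "continuous_on U W"
    using W by (cases k) (auto intro: differentiable_imp_continuous_on)
  then have "openin (top_of_set U) (U \<inter> (\<lambda>v. s * (N v \<bullet> W v)) -` {0<..})"
    using assms(3) by (intro continuous_openin_preimage_gen continuous_intros) auto
  then show V: "open V"
    using assms(1) openin_open_trans unfolding V_def
    by (simp add: vimage_def Int_def)
  have abs: "\<bar>N v \<bullet> W v\<bar> = norm (W v)" "W v = (N v \<bullet> W v) *\<^sub>R N v" if "v \<in> U" for v
    using unit_normal_eq[OF assms(4)[OF that] assms(5)[OF that] assms(5)[OF that]]
    by (auto simp: W_def)
  have pos: "norm (W v) > 0" if "v \<in> U" for v
    using assms(6)[OF that] by (simp add: W_def)
  then show "u \<in> V"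
    using assms(7) abs(1)[OF assms(7)] unfolding V_def s_def
    by (auto simp: sgn_if zero_less_mult_iff)
  show "V \<subseteq> U"
    by (auto simp: V_def)
  \<comment> \<open>On \<open>V\<close> the sign is still \<open>s\<close>, so <N,W> = s |W| with s
    s = 1, and W = <N,W> N can be solved for N.\<close>
  have eq: "(s * inverse (norm (W v))) *\<^sub>R W v = N v" if "v \<in> V" for v
  proof -
    have v: "v \<in> U" "0 < s * (N v \<bullet> W v)"
      using that by (auto simp: V_def)
    have "N v \<bullet> W v = s * norm (W v)"
      using v abs(1)[OF v(1)] unfolding s_def by (auto simp: sgn_if zero_less_mult_iff split: if_splits)
    moreover have "s * s = 1"
      using v(2) by (auto simp: s_def sgn_if split: if_splits)
    ultimately have "(s * inverse (norm (W v))) * (N v \<bullet> W v) = 1"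
      using pos[OF v(1)] by (simp add: field_simps)
    then show ?thesis
      using abs(2)[OF v(1)] by (metis scaleR_scaleR scaleR_one)
  qed
  have WV: "Ck_on k V W"
    using W \<open>V \<subseteq> U\<close> by (rule Ck_on_subset)
  have "Ck_on k V (\<lambda>v. inverse (norm (W v)))"
    using WV pos \<open>V \<subseteq> U\<close> by (intro Ck_on_inverse_norm[OF V]) auto
  then have "Ck_on k V (\<lambda>v. (s * inverse (norm (W v))) *\<^sub>R W v)"
    by (rule Ck_on_bilinear[OF V bounded_bilinear_scaleR
          Ck_on_bilinear[OF V bounded_bilinear_mult Ck_on_const] WV])
  from Ck_on_cong[OF V _ this] eq show "Ck_on k V N"
    by blast
qed

subsection \<open>The Beltrami operator of the second fundamental form\<close>

text \<open>Intended for a neighbourhood inside a chart domain, small enough that the normal is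
  already known to be \<open>C\<^sup>2\<close>; its second derivatives enter the Beltrami
  operator.\<close>

locale surface_patch =
  fixes U :: "(real^2) set" and X N :: "real^2 \<Rightarrow> real^3"
  assumes open_U: "open U"
    and Ck_X: "Ck_on 3 U X"
    and Ck_N: "Ck_on 2 U N"
    and norm_N: "v \<in> U \<Longrightarrow> norm (N v) = 1"
    and N_orth: "v \<in> U \<Longrightarrow> N v \<bullet> pd i X v = 0"
    and immersed: "v \<in> U \<Longrightarrow> cross3 (pd 1 X v) (pd 2 X v) \<noteq> 0"
begin

lemma differentiable_X_N:
  assumes "v \<in> U"
  shows "X differentiable (at v)" "pd i X differentiable (at v)"
    "pd j (pd i X) differentiable (at v)" "N differentiable (at v)" "pd i N differentiable (at v)"
  using assms Ck_X Ck_N open_U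
  by (auto simp: numeral_2_eq_2 numeral_3_eq_3 intro: differentiable_onD_open)

lemma pd_X_commute: "v \<in> U \<Longrightarrow> pd i (pd j X) v = pd j (pd i X) v"
  using Ck_X Ck_on_Suc_imp[of 2 U X] by (intro pd_commute[OF open_U]) (auto simp: numeral_3_eq_3 numeral_2_eq_2)

section \<open>Derivatives of the unit normal and of the fundamental forms\<close>

lemma pd_N_orth:
  assumes "v \<in> U"
  shows "pd i N v \<bullet> N v = 0"
proof -
  have "pd i (\<lambda>v. N v \<bullet> N v) v = pd i (\<lambda>v. 1) v"
    using norm_N by (intro pd_cong[OF open_U assms]) (simp add: norm_eq_1)
  then show ?thesis
    using differentiable_X_N[OF assms] by (simp add: pd_inner inner_commute)
qed

lemma pd_pd_N_inner_N:
  assumes "v \<in> U"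
  shows "pd i (pd j N) v \<bullet> N v = - (pd i N v \<bullet> pd j N v)"
proof -
  have "pd i (\<lambda>v. pd j N v \<bullet> N v) v = pd i (\<lambda>v. 0) v"
    using pd_N_orth by (intro pd_cong[OF open_U assms])
  then show ?thesis
    using differentiable_X_N[OF assms] by (simp add: pd_inner inner_commute)
qed

text \<open>Differentiating <x_i, n> = 0 moves one derivative from x to n. In this form the
  derivative of b_ij brings in second derivatives of n, which links it to the Beltrami
  operator.\<close>

lemma form_II_eq:
  assumes "v \<in> U"
  shows "form_II X N v $ i $ j = - (pd i X v \<bullet> pd j N v)"
proof -
  have "pd j (\<lambda>v. pd i X v \<bullet> N v) v = pd j (\<lambda>v. 0) v"
    using N_orth by (intro pd_cong[OF open_U assms]) (simp add: inner_commute)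
  then show ?thesis
    using differentiable_X_N[OF assms] by (simp add: pd_inner form_II_def)
qed

lemma form_II_sym: "v \<in> U \<Longrightarrow> form_II X N v $ i $ j = form_II X N v $ j $ i"
  using pd_X_commute[of v i j] by (simp add: form_II_def)

lemma pd_form_II:
  assumes "v \<in> U"
  shows "pd m (\<lambda>v. form_II X N v $ i $ j) v
    = - (pd m (pd i X) v \<bullet> pd j N v) - pd i X v \<bullet> pd m (pd j N) v"
proof -
  have "pd m (\<lambda>v. form_II X N v $ i $ j) v = pd m (\<lambda>v. - (pd i X v \<bullet> pd j N v)) v"
    by (rule pd_cong[OF open_U assms form_II_eq])
  then show ?thesis
    using differentiable_X_N[OF assms] by (simp add: pd_inner pd_minus)
qed

lemma pd_form_II_sym:
  "v \<in> U \<Longrightarrow> pd m (\<lambda>v. form_II X N v $ i $ j) v = pd m (\<lambda>v. form_II X N v $ j $ i) v"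
  by (rule pd_cong[OF open_U _ form_II_sym])

lemma pd_form_I:
  assumes "v \<in> U"
  shows "pd m (\<lambda>v. form_I X v $ i $ j) v
    = pd m (pd i X) v \<bullet> pd j X v + pd m (pd j X) v \<bullet> pd i X v"
  using differentiable_X_N[OF assms] by (simp add: form_I_def pd_inner inner_commute)

lemma form_I_sym: "form_I X v $ i $ j = form_I X v $ j $ i"
  by (simp add: form_I_def inner_commute)

lemma det_form_I_pos:
  assumes "v \<in> U"
  shows "det (form_I X v) > 0"
  using immersed[OF assms] det_gram_2[of "\<lambda>i. pd i X v"] by (simp add: form_I_def)

lemma tangent_normal_eqI:
  assumes "v \<in> U" "\<And>m. y \<bullet> pd m X v = z \<bullet> pd m X v" "y \<bullet> N v = z \<bullet> N v"
  shows "y = z"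
  using assms by (intro orthogonal_frame_eqI[OF norm_N N_orth N_orth immersed]) auto

text \<open>Both sides are tangential, and both pair with x_m to minus the Kronecker delta: b^ij
  meets <n_j, x_m> = -b_jm, while g^ik meets <x_k, x_m> = g_km.\<close>

lemma weingarten:
  assumes "v \<in> U" and ne: "det (form_II X N v) \<noteq> 0"
  shows "(\<Sum>j\<in>UNIV. matrix_inv (form_II X N v) $ i $ j *\<^sub>R pd j N v)
    = - (\<Sum>k\<in>UNIV. matrix_inv (form_I X v) $ i $ k *\<^sub>R pd k X v)"
proof (rule tangent_normal_eqI[OF \<open>v \<in> U\<close>])
  fix m
  have "pd j N v \<bullet> pd m X v = - form_II X N v $ j $ m" for j
    using form_II_eq[OF assms(1), of m j] form_II_sym[OF assms(1), of m j]
    by (simp add: inner_commute)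
  moreover have "pd k X v \<bullet> pd m X v = form_I X v $ k $ m" for k
    by (simp add: form_I_def)
  moreover have "det (form_I X v) \<noteq> 0"
    using det_form_I_pos[OF assms(1)] by simp
  ultimately show "(\<Sum>j\<in>UNIV. matrix_inv (form_II X N v) $ i $ j *\<^sub>R pd j N v) \<bullet> pd m X v
      = - (\<Sum>k\<in>UNIV. matrix_inv (form_I X v) $ i $ k *\<^sub>R pd k X v) \<bullet> pd m X v"
    using matrix_inv_mult_component(1)[OF ne, of i m]
      matrix_inv_mult_component(1)[of "form_I X v" i m]
    by (simp add: inner_sum_left sum_negf)
next
  show "(\<Sum>j\<in>UNIV. matrix_inv (form_II X N v) $ i $ j *\<^sub>R pd j N v) \<bullet> N v
      = - (\<Sum>k\<in>UNIV. matrix_inv (form_I X v) $ i $ k *\<^sub>R pd k X v) \<bullet> N v"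
    using pd_N_orth[OF assms(1)] N_orth[OF assms(1)]
    by (simp add: inner_sum_left inner_commute[of "pd _ X v"])
qed

text \<open>The logarithmic derivative of K = det b / det g, with Jacobi's formula applied to both
  determinants.\<close>

lemma pd_gauss_curvature:
  assumes "v \<in> U" and ne: "det (form_II X N v) \<noteq> 0"
  shows "pd m (gauss_curvature X N) v = gauss_curvature X N v *
    ((\<Sum>i\<in>UNIV. \<Sum>j\<in>UNIV. matrix_inv (form_II X N v) $ i $ j * pd m (\<lambda>v. form_II X N v $ i $ j) v)
     - 2 * (\<Sum>i\<in>UNIV. \<Sum>k\<in>UNIV. matrix_inv (form_I X v) $ i $ k * (pd m (pd i X) v \<bullet> pd k X v)))"
proof -
  have d1: "(\<lambda>v. form_I X v $ i $ j) differentiable (at v)"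
    and d2: "(\<lambda>v. form_II X N v $ i $ j) differentiable (at v)" for i j
    using differentiable_X_N[OF assms(1)]
    by (auto simp: form_I_def form_II_def intro: differentiable_inner)
  have ne1: "det (form_I X v) \<noteq> 0"
    using det_form_I_pos[OF assms(1)] by simp
  have dd: "(\<lambda>v. det (form_I X v)) differentiable (at v)" "(\<lambda>v. det (form_II X N v)) differentiable (at v)"
    unfolding det_2 by (intro differentiable_diff differentiable_mult d1 d2)+
  have "pd m (gauss_curvature X N) v = pd m (\<lambda>v. det (form_II X N v) / det (form_I X v)) v"
    by (simp add: gauss_curvature_def[abs_def])
  also have "\<dots> = gauss_curvature X N v *
    ((\<Sum>i\<in>UNIV. \<Sum>j\<in>UNIV. matrix_inv (form_II X N v) $ i $ j * pd m (\<lambda>v. form_II X N v $ j $ i) v)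
     - (\<Sum>i\<in>UNIV. \<Sum>j\<in>UNIV. matrix_inv (form_I X v) $ i $ j * pd m (\<lambda>v. form_I X v $ j $ i) v))"
    unfolding pd_divide[OF dd(2,1) ne1] pd_det_2[OF d1 ne1] pd_det_2[OF d2 ne] gauss_curvature_def
    using ne1 by (simp add: field_simps power2_eq_square)
  \<comment> \<open>The two terms of the derivative of g_ij contribute equally when contracted with
    the symmetric inverse; this is the factor 2.\<close>
  also have "(\<Sum>i\<in>UNIV. \<Sum>j\<in>UNIV. matrix_inv (form_I X v) $ i $ j * pd m (\<lambda>v. form_I X v $ j $ i) v)
    = 2 * (\<Sum>i\<in>UNIV. \<Sum>k\<in>UNIV. matrix_inv (form_I X v) $ i $ k * (pd m (pd i X) v \<bullet> pd k X v))"
    unfolding pd_form_I[OF assms(1)]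
    using matrix_inv_symmetric_2[OF ne1 form_I_sym, of 1 2]
    by (simp add: sum_2 inner_commute algebra_simps)
  finally show ?thesis
    by (simp add: pd_form_II_sym[OF assms(1)])
qed

lemma cov_deriv2_N_inner_tangent:
  assumes "v \<in> U" and ne: "det (form_II X N v) \<noteq> 0"
  shows "cov_deriv2 (form_II X N) i j N v \<bullet> pd m X v =
    (pd j (\<lambda>v. form_II X N v $ i $ m) v - pd i (\<lambda>v. form_II X N v $ j $ m) v
      - pd m (\<lambda>v. form_II X N v $ i $ j) v) / 2 - pd m (pd i X) v \<bullet> pd j N v"
proof -
  let ?b = "form_II X N v" and ?\<Gamma> = "\<lambda>k. christoffel (form_II X N) k i j v"
  let ?c = "\<lambda>l. pd i (\<lambda>v. form_II X N v $ j $ l) v + pd j (\<lambda>v. form_II X N v $ i $ l) v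
      - pd l (\<lambda>v. form_II X N v $ i $ j) v"
  have "pd k N v \<bullet> pd m X v = - ?b $ m $ k" for k
    using form_II_eq[OF assms(1), of m k] by (simp add: inner_commute)
  then have "(\<Sum>k\<in>UNIV. ?\<Gamma> k *\<^sub>R pd k N v) \<bullet> pd m X v = - (\<Sum>k\<in>UNIV. ?b $ m $ k * ?\<Gamma> k)"
    by (simp add: inner_sum_left sum_negf mult.commute)
  also have "(\<Sum>k\<in>UNIV. ?b $ m $ k * ?\<Gamma> k)
      = (\<Sum>l\<in>UNIV. (\<Sum>k\<in>UNIV. ?b $ m $ k * matrix_inv ?b $ k $ l) * ?c l) / 2"
    by (simp add: christoffel_def sum_2 field_simps)
  \<comment> \<open>The b_mk coming from <n_k, x_m> cancels the inverse inside the Christoffel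
    symbol, leaving only the summand l = m.\<close>
  also have "\<dots> = ?c m / 2"
    by (simp add: matrix_inv_mult_component(2)[OF ne] if_distrib[of "\<lambda>t. t * _"] cong: if_cong)
  finally have 1: "(\<Sum>k\<in>UNIV. ?\<Gamma> k *\<^sub>R pd k N v) \<bullet> pd m X v = - (?c m / 2)"
    .
  \<comment> \<open>Here s is the connection term, r is <n_ij, x_m>, and A, B, C are the derivatives
    of b_jm, b_im, b_ij along i, j, m; half of the -A in r is cancelled by -s.\<close>
  have arith: "t = r - s \<Longrightarrow> s = - ((A + B - C) / 2) \<Longrightarrow> r = - A - p \<Longrightarrow> t = (B - A - C) / 2 - p"
    for t r s A B C p :: real by argo
  have "pd i (pd j N) v \<bullet> pd m X v
      = - pd i (\<lambda>v. form_II X N v $ j $ m) v - pd m (pd i X) v \<bullet> pd j N v"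
    using pd_form_II[OF assms(1), of i m j] pd_form_II_sym[OF assms(1), of i j m]
      pd_X_commute[OF assms(1), of i m] by (simp add: inner_commute)
  moreover have "cov_deriv2 (form_II X N) i j N v \<bullet> pd m X v
      = pd i (pd j N) v \<bullet> pd m X v - (\<Sum>k\<in>UNIV. ?\<Gamma> k *\<^sub>R pd k N v) \<bullet> pd m X v"
    by (simp add: cov_deriv2_def inner_diff_left)
  ultimately show ?thesis
    by (intro arith[OF _ 1])
qed

section \<open>Tangential and normal components of the Beltrami operator of the normal\<close>

lemma beltrami2_N_inner_tangent:
  assumes "v \<in> U" and ne: "det (form_II X N v) \<noteq> 0"
  shows "beltrami2 (form_II X N) N v \<bullet> pd m X v
    = pd m (gauss_curvature X N) v / (2 * gauss_curvature X N v)"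
proof -
  let ?bi = "matrix_inv (form_II X N v)" and ?gi = "matrix_inv (form_I X v)"
  let ?D = "\<lambda>m i j. pd m (\<lambda>v. form_II X N v $ i $ j) v"
  have bi: "?bi $ 2 $ 1 = ?bi $ 1 $ 2"
    by (rule matrix_inv_symmetric_2[OF ne form_II_sym[OF assms(1)]])
  have "beltrami2 (form_II X N) N v \<bullet> pd m X v
      = - (\<Sum>i\<in>UNIV. \<Sum>j\<in>UNIV. ?bi $ i $ j *
        ((?D j i m - ?D i j m - ?D m i j) / 2 - pd m (pd i X) v \<bullet> pd j N v))"
    by (simp add: beltrami2_def inner_sum_left cov_deriv2_N_inner_tangent[OF assms])
  \<comment> \<open>The terms \<open>?D j i m - ?D i j m\<close> are antisymmetric in i and j, so
    they vanish against the symmetric inverse of b.\<close>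
  also have "\<dots> = (\<Sum>i\<in>UNIV. \<Sum>j\<in>UNIV. ?bi $ i $ j * ?D m i j) / 2
      + (\<Sum>i\<in>UNIV. pd m (pd i X) v \<bullet> (\<Sum>j\<in>UNIV. ?bi $ i $ j *\<^sub>R pd j N v))"
    by (simp add: sum_2 bi inner_add_right field_simps)
  also have "\<dots> = (\<Sum>i\<in>UNIV. \<Sum>j\<in>UNIV. ?bi $ i $ j * ?D m i j) / 2
      - (\<Sum>i\<in>UNIV. \<Sum>k\<in>UNIV. ?gi $ i $ k * (pd m (pd i X) v \<bullet> pd k X v))"
    by (simp add: weingarten[OF assms] inner_sum_right sum_negf)
  moreover have "gauss_curvature X N v \<noteq> 0"
    using ne det_form_I_pos[OF assms(1)] by (simp add: gauss_curvature_def)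
  ultimately show ?thesis
    by (simp add: pd_gauss_curvature[OF assms] diff_divide_distrib)
qed

lemma beltrami2_N_inner_N:
  assumes "v \<in> U" and ne: "det (form_II X N v) \<noteq> 0"
  shows "beltrami2 (form_II X N) N v \<bullet> N v = 2 * mean_curvature X N v"
proof -
  let ?bi = "matrix_inv (form_II X N v)" and ?gi = "matrix_inv (form_I X v)"
  \<comment> \<open>The connection terms drop out because every n_k is orthogonal to n.\<close>
  have "cov_deriv2 (form_II X N) i j N v \<bullet> N v = - (pd i N v \<bullet> pd j N v)" for i j
    by (simp add: cov_deriv2_def inner_diff_left inner_sum_left pd_N_orth[OF assms(1)]
        pd_pd_N_inner_N[OF assms(1)])
  then have "beltrami2 (form_II X N) N v \<bullet> N v
      = (\<Sum>i\<in>UNIV. pd i N v \<bullet> (\<Sum>j\<in>UNIV. ?bi $ i $ j *\<^sub>R pd j N v))"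
    by (simp add: beltrami2_def inner_sum_left inner_sum_right sum_negf)
  also have "\<dots> = (\<Sum>i\<in>UNIV. \<Sum>k\<in>UNIV. ?gi $ i $ k * form_II X N v $ i $ k)"
  proof -
    have "pd i N v \<bullet> pd k X v = - form_II X N v $ i $ k" for i k
      using form_II_eq[OF assms(1), of k i] form_II_sym[OF assms(1), of i k]
      by (simp add: inner_commute)
    then show ?thesis
      by (simp add: weingarten[OF assms] inner_sum_right sum_negf)
  qed
  finally show ?thesis
    by (simp add: mean_curvature_def)
qed

lemma beltrami2_form_II_normal:
  assumes "v \<in> U" and ne: "det (form_II X N v) \<noteq> 0"
  shows "beltrami2 (form_II X N) N v =
    (1 / (2 * gauss_curvature X N v)) *\<^sub>R beltrami1 (form_I X) (gauss_curvature X N) X v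
      + (2 * mean_curvature X N v) *\<^sub>R N v" (is "_ = ?rhs")
proof (rule tangent_normal_eqI[OF assms(1)])
  let ?gi = "matrix_inv (form_I X v)" and ?K = "gauss_curvature X N"
  have ne1: "det (form_I X v) \<noteq> 0"
    using det_form_I_pos[OF assms(1)] by simp
  fix m
  \<comment> \<open>\<open>beltrami1\<close> applied to K and x is the tangential gradient of K: the
    factor <x_j, x_m> = g_jm cancels the inverse of g, so pairing with x_m returns the derivative of
    K along m.\<close>
  have "beltrami1 (form_I X) ?K X v \<bullet> pd m X v
      = (\<Sum>i\<in>UNIV. pd i ?K v * (\<Sum>j\<in>UNIV. ?gi $ i $ j * form_I X v $ j $ m))"
    by (simp add: beltrami1_def inner_sum_left form_I_def sum_distrib_left mult_ac)
  also have "\<dots> = pd m ?K v"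
    by (simp add: matrix_inv_mult_component(1)[OF ne1] if_distrib[of "\<lambda>t. _ * t"] cong: if_cong)
  finally show "beltrami2 (form_II X N) N v \<bullet> pd m X v = ?rhs \<bullet> pd m X v"
    by (simp add: beltrami2_N_inner_tangent[OF assms] inner_add_left N_orth[OF assms(1)])
next
  have "N v \<bullet> N v = 1"
    using norm_N[OF assms(1)] by (simp add: norm_eq_1)
  moreover have "pd i X v \<bullet> N v = 0" for i
    using N_orth[OF assms(1)] by (simp add: inner_commute)
  ultimately show "beltrami2 (form_II X N) N v \<bullet> N v = ?rhs \<bullet> N v"
    by (simp add: beltrami2_N_inner_N[OF assms] inner_add_left beltrami1_def inner_sum_left)
qed

end

section \<open>From a patch to the charts of the surface\<close>

theorem mainTheorem7:
  fixes M :: "'a topology"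
    and A :: "((real^2) set \<times> (real^2 \<Rightarrow> 'a)) set"
    and x n :: "'a \<Rightarrow> real^3"
  assumes "surface_in_E3 M A x"
    and "connected_space M"
    and "gauss_map M A x n"
    and "\<forall>(U, \<phi>)\<in>A. \<forall>u\<in>U. gauss_curvature (x \<circ> \<phi>) (n \<circ> \<phi>) u > 0"
  shows "\<forall>(U, \<phi>)\<in>A. \<forall>u\<in>U.
    (let X = x \<circ> \<phi>; N = n \<circ> \<phi>; K = gauss_curvature X N; H = mean_curvature X N in
      beltrami2 (form_II X N) N u =
        (1 / (2 * K u)) *\<^sub>R beltrami1 (form_I X) K X u + (2 * H u) *\<^sub>R N u)"
proof -
  have "beltrami2 (form_II (x \<circ> \<phi>) (n \<circ> \<phi>)) (n \<circ> \<phi>) u =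
      (1 / (2 * gauss_curvature (x \<circ> \<phi>) (n \<circ> \<phi>) u)) *\<^sub>R
        beltrami1 (form_I (x \<circ> \<phi>)) (gauss_curvature (x \<circ> \<phi>) (n \<circ> \<phi>)) (x \<circ> \<phi>) u
      + (2 * mean_curvature (x \<circ> \<phi>) (n \<circ> \<phi>) u) *\<^sub>R (n \<circ> \<phi>) u"
    if "(U, \<phi>) \<in> A" "u \<in> U" for U \<phi> u
  proof -
    let ?X = "x \<circ> \<phi>" and ?N = "n \<circ> \<phi>"
    have chart: "open U" "openin M (\<phi> ` U)"
        "homeomorphic_map (top_of_set U) (subtopology M (\<phi> ` U)) \<phi>"
      and X: "Ck_on 3 U ?X" "\<And>v. v \<in> U \<Longrightarrow> inj (frechet_derivative ?X (at v))"
      using assms(1) that(1) unfolding surface_in_E3_def C3_atlas_def by auto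
    have "\<phi> v \<in> topspace M" if "v \<in> U" for v
      using openin_subset[OF chart(2)] that by auto
    then have N: "norm (?N v) = 1" "?N v \<bullet> pd i ?X v = 0" if "v \<in> U" for v i
      using assms(3) \<open>(U, \<phi>) \<in> A\<close> that unfolding gauss_map_def by auto
    have "continuous_map (top_of_set U) M \<phi>"
      using homeomorphic_imp_continuous_map[OF chart(3)] continuous_map_into_fulltopology by blast
    then have cont: "continuous_on U ?N"
      using continuous_map_compose[of _ M \<phi> euclidean n] assms(3)
      by (simp add: gauss_map_def o_def flip: continuous_map_iff_continuous)
    have imm: "cross3 (pd 1 ?X v) (pd 2 ?X v) \<noteq> 0" if "v \<in> U" for v
    proof -
      have "?X differentiable (at v)"
        using X(1) chart(1) that by (auto simp: numeral_3_eq_3 intro: differentiable_onD_open)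
      then show ?thesis
        unfolding pd_def by (intro inj_linear_cross3_axis linear_frechet_derivative X(2) that)
    qed
    have "Ck_on (Suc 2) U ?X"
      using X(1) by (simp add: numeral_3_eq_3 numeral_2_eq_2)
    \<comment> \<open>The formula at \<open>u\<close> involves only derivatives at \<open>u\<close>,
      so it may be proved on a smaller neighbourhood where the normal is
      \<open>C\<^sup>2\<close>.\<close>
    from unit_normal_locally_Ck[OF chart(1) this cont N imm \<open>u \<in> U\<close>]
    obtain V where V: "open V" "u \<in> V" "V \<subseteq> U" "Ck_on 2 V ?N" .
    interpret surface_patch V ?X ?N
      using V Ck_on_subset[OF X(1)] N imm by unfold_locales auto
    \<comment> \<open>If det b vanished, the quotient defining K would be 0 instead of
      positive.\<close>
    have "det (form_II ?X ?N u) \<noteq> 0"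
      using assms(4) that unfolding gauss_curvature_def by fastforce
    then show ?thesis
      by (rule beltrami2_form_II_normal[OF V(2)])
  qed
  then show ?thesis
    unfolding Let_def by blast
qed

end
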